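(* Let $D$ be a finite set with $|D|\ge 2$, let $\mathbb{P}_0=(p_{0s})_{s\in D}$ be a probability measure on $D$ with $p_{0s}>0$ for all $s$, and let $c\ge 1$ satisfy $c<\min_{s\in D}\frac{1}{1-p_{0s}}$. Let $S=(S^1,\dots,S^K):D\to\mathbb{R}^K$ be the payoffs of $K\ge 1$ risky assets with prices $\pi\in\mathbb{R}^K$, such that $S^1,\dots,S^K$ and the constant payoff $1$ are linearly independent, let $w_0$ be the initial wealth, and let $\Theta\subseteq\mathbb{R}^K$ be the set of admissible strategies. Let $u$ be a strictly concave utility function. If $\alpha\in[1/2,1]$, then the objective function $V_\alpha:\Theta\to\mathbb{R}$ is strictly concave.
   Context: For $\theta\in\Theta$ the terminal wealth is $W^\theta=w_0+\theta\cdot(S-\pi)$, and $$V_\alpha(\theta)=\alpha\min_{P\in\mathcal{X}}\mathbb{E}_P[u(W^\theta)]+(1-\alpha)\max_{P\in\mathcal{X}}\mathbb{E}_P[u(W^\theta)],$$ where $$\mathcal{X}=\Big\{P: P(s)\ge 0\ \forall s\in D,\ \sum_{s\in D}P(s)=1,\ \sum_{s\in D}\frac{P(s)^2}{p_{0s}}\le c\Big\}.$$ The utility function $u$ is real-valued either on all of $\mathbb{R}$, in which case $\Theta=\mathbb{R}^K$, or only on $(0,\infty)$, in which case $w_0>0$ and $\Theta=\{\theta\in\mathbb{R}^K: w_0+\theta\cdot(S_s-\pi)>0\ \forall s\in D\}$. *)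

theory Defs
  imports "HOL-Analysis.Analysis"
begin

text \<open>The finite type \<open>'d\<close> is the state space \<open>D\<close> and the finite type \<open>'k\<close> indexes the
  \<open>K = CARD('k)\<close> risky assets (so \<open>K \<ge> 1\<close>). A probability on \<open>D\<close> is a vector in \<open>real ^ 'd\<close>;
  \<open>S s $ k\<close> is the payoff of asset \<open>k\<close> in state \<open>s\<close>.\<close>

definition strictly_concave_on :: "'a::real_vector set \<Rightarrow> ('a \<Rightarrow> real) \<Rightarrow> bool" where
  "strictly_concave_on A f \<longleftrightarrow> convex A \<and>
     (\<forall>x\<in>A. \<forall>y\<in>A. \<forall>t. x \<noteq> y \<and> 0 < t \<and> t < 1 \<longrightarrow>
        (1 - t) * f x + t * f y < f ((1 - t) *\<^sub>R x + t *\<^sub>R y))"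

definition prob_vector :: "real ^ 'd \<Rightarrow> bool" where
  "prob_vector P \<longleftrightarrow> (\<forall>s. 0 \<le> P $ s) \<and> (\<Sum>s\<in>UNIV. P $ s) = 1"

definition expect :: "real ^ 'd \<Rightarrow> ('d \<Rightarrow> real) \<Rightarrow> real" where
  "expect P f = (\<Sum>s\<in>UNIV. P $ s * f s)"

definition priors :: "real ^ 'd \<Rightarrow> real \<Rightarrow> (real ^ 'd) set" where
  "priors p0 c = {P. prob_vector P \<and> (\<Sum>s\<in>UNIV. (P $ s)\<^sup>2 / p0 $ s) \<le> c}"

definition wealth :: "real \<Rightarrow> ('d \<Rightarrow> real ^ 'k) \<Rightarrow> real ^ 'k \<Rightarrow> real ^ 'k \<Rightarrow> 'd \<Rightarrow> real" where
  "wealth w0 S \<pi> \<theta> s = w0 + \<theta> \<bullet> (S s - \<pi>)"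

text \<open>A family (rather than a set) of vectors is linearly independent: repetitions are excluded
  by injectivity.\<close>

definition independent_family :: "('i \<Rightarrow> 'v::real_vector) \<Rightarrow> bool" where
  "independent_family v \<longleftrightarrow> inj v \<and> independent (range v)"

text \<open>The payoffs as vectors in \<open>real ^ 'd\<close>; the index \<open>None\<close> stands for the constant payoff 1.\<close>

definition payoffs :: "('d \<Rightarrow> real ^ 'k) \<Rightarrow> 'k option \<Rightarrow> real ^ 'd" where
  "payoffs S i = (case i of None \<Rightarrow> (\<chi> s. 1) | Some k \<Rightarrow> (\<chi> s. S s $ k))"

text \<open>\<open>Least\<close> and \<open>Greatest\<close> are a true minimum and maximum here: see \<open>min_attained\<close> and
  \<open>max_attained\<close> below.\<close>

definition min_expect :: "(real ^ 'd) set \<Rightarrow> ('d \<Rightarrow> real) \<Rightarrow> real" where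
  "min_expect X f = (LEAST v. v \<in> (\<lambda>P. expect P f) ` X)"

definition max_expect :: "(real ^ 'd) set \<Rightarrow> ('d \<Rightarrow> real) \<Rightarrow> real" where
  "max_expect X f = (GREATEST v. v \<in> (\<lambda>P. expect P f) ` X)"

definition V :: "real \<Rightarrow> (real ^ 'd) set \<Rightarrow> (real \<Rightarrow> real) \<Rightarrow> real \<Rightarrow> ('d \<Rightarrow> real ^ 'k) \<Rightarrow> real ^ 'k
    \<Rightarrow> real ^ 'k \<Rightarrow> real" where
  "V \<alpha> X u w0 S \<pi> \<theta> =
     \<alpha> * min_expect X (\<lambda>s. u (wealth w0 S \<pi> \<theta> s))
     + (1 - \<alpha>) * max_expect X (\<lambda>s. u (wealth w0 S \<pi> \<theta> s))"

lemma continuous_on_expect: "continuous_on A (\<lambda>P. expect P f)"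
  unfolding expect_def by (intro continuous_intros)

lemma compact_priors: "compact (priors p0 c)" for p0 :: "real ^ 'd"
proof -
  have eq: "priors p0 c = (\<Inter>s. {P. 0 \<le> P $ s}) \<inter> {P. (\<Sum>s\<in>UNIV. P $ s) = 1}
      \<inter> {P. (\<Sum>s\<in>UNIV. (P $ s)\<^sup>2 / p0 $ s) \<le> c}"
    by (auto simp: priors_def prob_vector_def)
  have cont: "continuous_on UNIV (\<lambda>P::real ^ 'd. (\<Sum>s\<in>UNIV. (P $ s)\<^sup>2 / p0 $ s))"
    unfolding divide_inverse by (intro continuous_intros)
  have cl: "closed (priors p0 c)"
    unfolding eq
    by (intro closed_Int closed_INT ballI closed_Collect_le closed_Collect_eq continuous_intros cont)
  have "norm P \<le> 1" if "P \<in> priors p0 c" for P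
    using norm_le_l1_cart[of P] that by (simp add: priors_def prob_vector_def)
  then have "bounded (priors p0 c)"
    by (rule boundedI)
  with cl show ?thesis by (simp add: compact_eq_bounded_closed)
qed

lemma prior_in_priors:
  assumes "prob_vector p0" "\<And>s. 0 < p0 $ s" "1 \<le> c"
  shows "p0 \<in> priors p0 c"
proof -
  have "(p0 $ s)\<^sup>2 / p0 $ s = p0 $ s" for s
    using assms(2)[of s] by (simp add: power2_eq_square)
  then show ?thesis using assms by (simp add: priors_def prob_vector_def)
qed

lemma min_attained:
  assumes "prob_vector p0" "\<And>s. 0 < p0 $ s" "1 \<le> c"
  shows "\<exists>P\<in>priors p0 c. min_expect (priors p0 c) f = expect P f
           \<and> (\<forall>Q\<in>priors p0 c. expect P f \<le> expect Q f)"
proof -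
  have "priors p0 c \<noteq> {}" using prior_in_priors[OF assms] by blast
  then obtain P where P: "P \<in> priors p0 c" "\<forall>Q\<in>priors p0 c. expect P f \<le> expect Q f"
    using continuous_attains_inf[OF compact_priors _ continuous_on_expect] by blast
  then have "min_expect (priors p0 c) f = expect P f"
    unfolding min_expect_def by (intro Least_equality) auto
  with P show ?thesis by blast
qed

lemma max_attained:
  assumes "prob_vector p0" "\<And>s. 0 < p0 $ s" "1 \<le> c"
  shows "\<exists>P\<in>priors p0 c. max_expect (priors p0 c) f = expect P f
           \<and> (\<forall>Q\<in>priors p0 c. expect Q f \<le> expect P f)"
proof -
  have "priors p0 c \<noteq> {}" using prior_in_priors[OF assms] by blast
  then obtain P where P: "P \<in> priors p0 c" "\<forall>Q\<in>priors p0 c. expect Q f \<le> expect P f"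
    using continuous_attains_sup[OF compact_priors _ continuous_on_expect] by blast
  then have "max_expect (priors p0 c) f = expect P f"
    unfolding max_expect_def by (intro Greatest_equality) auto
  with P show ?thesis by blast
qed

end

theory Submission
  imports Defs
begin

text \<open>The bound on \<open>c\<close> makes the nonnegativity constraint in \<open>priors p0 c\<close> slack, so that this
  set is an ellipsoid that is symmetric about \<open>p0\<close> and lies in the interior of the simplex. By the symmetry, the
  maximal and the minimal expectation of \<open>f\<close> add up to twice the \<open>p0\<close>-expectation, and \<open>V\<close> is
  \<open>2\<alpha> - 1\<close> times the minimal expectation plus \<open>2(1 - \<alpha>)\<close> times the \<open>p0\<close>-expectation of the
  utility of wealth. Both weights are nonnegative with sum 1, and both expectations are concave and
  strictly increasing in \<open>f\<close>, since all priors have full support; linear independence of the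
  payoffs makes distinct strategies differ in wealth in some state, where \<open>u\<close> is strictly
  concave.\<close>

text \<open>If \<open>Q $ s\<close> were at most 0, the other states would carry
  \<open>Q\<close>-mass at least 1 on \<open>p0\<close>-mass \<open>1 - p0 $ s\<close>, and
  Cauchy--Schwarz would force the sum of squares up to \<open>1 / (1 - p0 $ s)\<close>, above
  \<open>c\<close>. Negative entries of \<open>Q\<close> are allowed, so that reflected priors are
  covered.\<close>

lemma prior_weight_pos:
  fixes p0 Q :: "real ^ 'd"
  assumes p0: "prob_vector p0" "\<And>s. 0 < p0 $ s"
    and card: "CARD('d) \<ge> 2"
    and c: "c < (MIN s\<in>UNIV. 1 / (1 - p0 $ s))"
    and Q: "(\<Sum>s\<in>UNIV. Q $ s) = 1" "(\<Sum>s\<in>UNIV. (Q $ s)\<^sup>2 / p0 $ s) \<le> c"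
  shows "0 < Q $ s"
proof (rule ccontr)
  assume neg: "\<not> 0 < Q $ s"
  define a where "a = 1 / (1 - p0 $ s)"
  have rest: "(\<Sum>t\<in>UNIV - {s}. p0 $ t) = 1 - p0 $ s" "(\<Sum>t\<in>UNIV - {s}. Q $ t) = 1 - Q $ s"
    using p0(1) Q(1) by (simp_all add: prob_vector_def sum_diff1)
  \<comment> \<open>A second state exists, so \<open>1 - p0 $ s\<close> is positive and
    \<open>a\<close> is not the default value of a division by zero.\<close>
  have "card (UNIV - {s}) \<noteq> 0" using card by simp
  then have "UNIV - {s} \<noteq> {}" by (metis card.empty)
  then have "0 < (\<Sum>t\<in>UNIV - {s}. p0 $ t)"
    by (intro sum_pos p0(2)) simp_all
  then have a: "0 < a" "a * (1 - p0 $ s) = 1"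
    unfolding rest by (simp_all add: a_def)
  \<comment> \<open>The tangent at slope \<open>a\<close> replaces the Cauchy--Schwarz inequality.\<close>
  have tangent: "2 * a * Q $ t - a\<^sup>2 * p0 $ t \<le> (Q $ t)\<^sup>2 / p0 $ t" for t
  proof -
    have "0 \<le> (Q $ t - a * p0 $ t)\<^sup>2 / p0 $ t" using p0(2)[of t] by simp
    also have "\<dots> = (Q $ t)\<^sup>2 / p0 $ t - (2 * a * Q $ t - a\<^sup>2 * p0 $ t)"
      using p0(2)[of t] by (simp add: field_simps power2_eq_square)
    finally show ?thesis by simp
  qed
  have "a \<le> 2 * a * (1 - Q $ s) - a * (a * (1 - p0 $ s))"
    unfolding a(2) using a(1) mult_nonneg_nonpos[of a "Q $ s"] neg by (simp add: algebra_simps)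
  also have "\<dots> = (\<Sum>t\<in>UNIV - {s}. 2 * a * Q $ t - a\<^sup>2 * p0 $ t)"
    by (simp add: sum_subtractf power2_eq_square mult.assoc flip: sum_distrib_left rest)
  also have "\<dots> \<le> (\<Sum>t\<in>UNIV - {s}. (Q $ t)\<^sup>2 / p0 $ t)"
    by (intro sum_mono tangent)
  also have "\<dots> \<le> (\<Sum>t\<in>UNIV. (Q $ t)\<^sup>2 / p0 $ t)"
    by (intro sum_mono2) (auto intro!: divide_nonneg_pos p0(2))
  also have "\<dots> < a"
    using Q(2) c unfolding a_def by (simp add: Min_gr_iff) (meson le_less_trans)
  finally show False by simp
qed

text \<open>For vectors of mass 1 the sum of squares is 1 plus a weighted squared distance to
  \<open>p0\<close>, which the reflection preserves; \<open>prior_weight_pos\<close> then supplies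
  nonnegativity.\<close>

lemma priors_reflect:
  fixes p0 P :: "real ^ 'd"
  assumes p0: "prob_vector p0" "\<And>s. 0 < p0 $ s"
    and card: "CARD('d) \<ge> 2"
    and c: "c < (MIN s\<in>UNIV. 1 / (1 - p0 $ s))"
    and P: "P \<in> priors p0 c"
  shows "2 *\<^sub>R p0 - P \<in> priors p0 c"
proof -
  let ?Q = "2 *\<^sub>R p0 - P"
  have sum: "(\<Sum>s\<in>UNIV. ?Q $ s) = 1"
    using p0(1) P by (simp add: priors_def prob_vector_def sum_subtractf flip: sum_distrib_left)
  have "(?Q $ s)\<^sup>2 / p0 $ s = 4 * (p0 $ s - P $ s) + (P $ s)\<^sup>2 / p0 $ s" for s
    using p0(2)[of s] by (simp add: field_simps power2_eq_square)
  then have "(\<Sum>s\<in>UNIV. (?Q $ s)\<^sup>2 / p0 $ s) = (\<Sum>s\<in>UNIV. (P $ s)\<^sup>2 / p0 $ s)"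
    using p0(1) P
    by (simp add: sum.distrib sum_subtractf priors_def prob_vector_def flip: sum_distrib_left)
  then have "(\<Sum>s\<in>UNIV. (?Q $ s)\<^sup>2 / p0 $ s) \<le> c"
    using P by (simp add: priors_def)
  with sum show ?thesis
    using prior_weight_pos[OF p0 card c sum] by (simp add: priors_def prob_vector_def less_imp_le)
qed

lemma expect_reflect: "expect (2 *\<^sub>R p0 - P) f = 2 * expect p0 f - expect P f"
  by (simp add: expect_def left_diff_distrib sum_subtractf sum_distrib_left mult.assoc)

text \<open>The reflected minimiser bounds the maximum from below, and the reflected maximiser
  bounds it from above.\<close>

lemma max_expect_eq_reflected_min:
  fixes p0 :: "real ^ 'd"
  assumes p0: "prob_vector p0" "\<And>s. 0 < p0 $ s"
    and card: "CARD('d) \<ge> 2"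
    and c: "1 \<le> c" "c < (MIN s\<in>UNIV. 1 / (1 - p0 $ s))"
  shows "max_expect (priors p0 c) f = 2 * expect p0 f - min_expect (priors p0 c) f"
proof -
  obtain P where P: "P \<in> priors p0 c" "min_expect (priors p0 c) f = expect P f"
    "\<And>Q. Q \<in> priors p0 c \<Longrightarrow> expect P f \<le> expect Q f"
    using min_attained[OF p0 c(1)] by blast
  obtain R where R: "R \<in> priors p0 c" "max_expect (priors p0 c) f = expect R f"
    "\<And>Q. Q \<in> priors p0 c \<Longrightarrow> expect Q f \<le> expect R f"
    using max_attained[OF p0 c(1)] by blast
  show ?thesis
    using P(3)[OF priors_reflect[OF p0 card c(2) R(1)]] R(3)[OF priors_reflect[OF p0 card c(2) P(1)]]
      P(2) R(2) by (simp add: expect_reflect)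
qed

lemma expect_linear:
  "expect P (\<lambda>s. a * f s + b * g s) = a * expect P f + b * expect P g"
  by (simp add: expect_def sum.distrib sum_distrib_left algebra_simps)

lemma expect_strict_mono:
  fixes P :: "real ^ 'd"
  assumes "\<And>s. 0 < P $ s" "\<And>s. f s \<le> g s" "f s0 < g s0"
  shows "expect P f < expect P g"
  unfolding expect_def
  by (rule sum_strict_mono_ex1)
     (use assms in \<open>auto intro!: mult_left_mono mult_strict_left_mono less_imp_le exI[of _ s0]\<close>)

text \<open>A minimising prior for \<open>h\<close> bounds the other two minima from above, and its
  full support turns strictness in one state into a strict inequality of expectations.\<close>

lemma min_expect_strict_superadditive:
  fixes p0 :: "real ^ 'd"
  assumes p0: "prob_vector p0" "\<And>s. 0 < p0 $ s"
    and card: "CARD('d) \<ge> 2"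
    and c: "1 \<le> c" "c < (MIN s\<in>UNIV. 1 / (1 - p0 $ s))"
    and ab: "0 \<le> a" "0 \<le> b"
    and le: "\<And>s. a * f s + b * g s \<le> h s" and less: "a * f s0 + b * g s0 < h s0"
  shows "a * min_expect (priors p0 c) f + b * min_expect (priors p0 c) g < min_expect (priors p0 c) h"
proof -
  obtain P where P: "P \<in> priors p0 c" "min_expect (priors p0 c) h = expect P h"
    using min_attained[OF p0 c(1)] by blast
  have lower: "min_expect (priors p0 c) k \<le> expect P k" for k
    using min_attained[OF p0 c(1), of k] P(1) by auto
  have "a * min_expect (priors p0 c) f + b * min_expect (priors p0 c) g
      \<le> a * expect P f + b * expect P g"
    by (intro add_mono mult_left_mono lower ab)
  also have "\<dots> = expect P (\<lambda>s. a * f s + b * g s)"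
    by (simp add: expect_linear)
  also have "\<dots> < expect P h"
    using P(1) le less
    by (intro expect_strict_mono prior_weight_pos[OF p0 card c(2)]) (auto simp: priors_def prob_vector_def)
  finally show ?thesis using P(2) by simp
qed

lemma independent_family_sum_zero:
  fixes v :: "'i::finite \<Rightarrow> 'v::real_vector"
  assumes "independent_family v" and "(\<Sum>i\<in>UNIV. x i *\<^sub>R v i) = 0"
  shows "x i = 0"
proof -
  have inj: "inj v" and ind: "independent (range v)"
    using assms(1) by (auto simp: independent_family_def)
  have "(\<Sum>w\<in>range v. x (inv v w) *\<^sub>R w) = 0"
    using assms(2) inj by (simp add: sum.reindex)
  then have "x (inv v (v i)) = 0"
    using ind by (intro independentD[of "range v" "range v" "\<lambda>w. x (inv v w)"]) auto
  then show ?thesis using inj by simp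
qed

lemma wealth_inj:
  fixes S :: "'d::finite \<Rightarrow> real ^ 'k::finite"
  assumes ind: "independent_family (payoffs S)"
    and eq: "\<And>s. wealth w0 S \<pi> \<theta> s = wealth w0 S \<pi> \<theta>' s"
  shows "\<theta> = \<theta>'"
proof -
  \<comment> \<open>Equal wealth makes the portfolio \<open>\<theta> - \<theta>'\<close> pay its own
    cost in every state, which is a linear relation between the assets and the constant
    payoff.\<close>
  define x where "x i = (case i of None \<Rightarrow> - ((\<theta> - \<theta>') \<bullet> \<pi>) | Some k \<Rightarrow> (\<theta> - \<theta>') $ k)"
    for i :: "'k option"
  have "(\<Sum>i\<in>UNIV. x i *\<^sub>R payoffs S i) $ s = (\<theta> - \<theta>') \<bullet> (S s - \<pi>)" for s
    by (simp add: UNIV_option_conv sum.reindex x_def payoffs_def inner_diff_right)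
       (simp add: inner_vec_def)
  also have "(\<theta> - \<theta>') \<bullet> (S s - \<pi>) = 0" for s
    using eq[of s] by (simp add: wealth_def inner_diff_left)
  finally have "(\<Sum>i\<in>UNIV. x i *\<^sub>R payoffs S i) = 0"
    by (simp add: vec_eq_iff)
  then have "x (Some k) = 0" for k
    by (rule independent_family_sum_zero[OF ind])
  then show ?thesis by (simp add: x_def vec_eq_iff)
qed

lemma wealth_convex_comb:
  "wealth w0 S \<pi> ((1 - t) *\<^sub>R x + t *\<^sub>R y) s
    = (1 - t) *\<^sub>R wealth w0 S \<pi> x s + t *\<^sub>R wealth w0 S \<pi> y s"
  by (simp add: wealth_def inner_add_left algebra_simps)

theorem proposition2p5:
  fixes p0 :: "real ^ 'd" and c :: real
    and S :: "'d \<Rightarrow> real ^ 'k" and \<pi> :: "real ^ 'k" and w0 :: real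
    and \<Theta> :: "(real ^ 'k) set"
    and u :: "real \<Rightarrow> real" and U :: "real set" and \<alpha> :: real
  assumes "CARD('d) \<ge> 2"
    and "prob_vector p0" and "\<forall>s. 0 < p0 $ s"
    and "1 \<le> c" and "c < (MIN s\<in>UNIV. 1 / (1 - p0 $ s))"
    and "independent_family (payoffs S)"
    and "(U = UNIV \<and> \<Theta> = UNIV) \<or>
         (U = {0<..} \<and> 0 < w0 \<and> \<Theta> = {\<theta>. \<forall>s. 0 < w0 + \<theta> \<bullet> (S s - \<pi>)})"
    and "strictly_concave_on U u"
    and "\<alpha> \<in> {1/2..1}"
  shows "strictly_concave_on \<Theta> (V \<alpha> (priors p0 c) u w0 S \<pi>)"
proof -
  have p0: "prob_vector p0" "\<And>s. 0 < p0 $ s" using assms(2,3) by auto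
  note card = assms(1) and c = assms(4,5)
  \<comment> \<open>Both cases of the domain say the same: wealth stays in \<open>U\<close> in every
    state.\<close>
  have \<Theta>: "\<Theta> = {\<theta>. \<forall>s. wealth w0 S \<pi> \<theta> s \<in> U}"
    using assms(7) by (auto simp: wealth_def)
  have U: "convex U" using assms(8) by (simp add: strictly_concave_on_def)
  have "convex \<Theta>"
    unfolding \<Theta> convex_alt by (auto simp: wealth_convex_comb intro: convexD_alt[OF U, simplified])
  moreover have "(1 - t) * V \<alpha> (priors p0 c) u w0 S \<pi> x + t * V \<alpha> (priors p0 c) u w0 S \<pi> y
      < V \<alpha> (priors p0 c) u w0 S \<pi> ((1 - t) *\<^sub>R x + t *\<^sub>R y)"
    if x: "x \<in> \<Theta>" and y: "y \<in> \<Theta>" and "x \<noteq> y" and t: "0 < t" "t < 1" for x y t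
  proof -
    define f where "f \<theta> s = u (wealth w0 S \<pi> \<theta> s)" for \<theta> s
    define z where "z = (1 - t) *\<^sub>R x + t *\<^sub>R y"
    let ?m = "min_expect (priors p0 c)"
    have V: "V \<alpha> (priors p0 c) u w0 S \<pi> \<theta>
        = (2 * \<alpha> - 1) * ?m (f \<theta>) + 2 * (1 - \<alpha>) * expect p0 (f \<theta>)" for \<theta>
      unfolding V_def f_def max_expect_eq_reflected_min[OF p0 card c] by (simp add: algebra_simps)
    have strict: "(1 - t) * f x s + t * f y s < f z s"
      if "wealth w0 S \<pi> x s \<noteq> wealth w0 S \<pi> y s" for s
      using assms(8) x y that t
      unfolding f_def z_def wealth_convex_comb \<Theta> strictly_concave_on_def by auto
    \<comment> \<open>Where the two wealths agree, strict concavity is silent, but both sides are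
      equal.\<close>
    have le: "(1 - t) * f x s + t * f y s \<le> f z s" for s
    proof (cases "wealth w0 S \<pi> x s = wealth w0 S \<pi> y s")
      case True
      then show ?thesis
        unfolding f_def z_def wealth_convex_comb
        by (simp flip: scaleR_left_distrib distrib_right)
    qed (use strict in \<open>auto intro: less_imp_le\<close>)
    obtain s0 where less: "(1 - t) * f x s0 + t * f y s0 < f z s0"
      using wealth_inj[OF assms(6)] \<open>x \<noteq> y\<close> strict by blast
    have m: "(1 - t) * ?m (f x) + t * ?m (f y) < ?m (f z)"
      using t le less by (intro min_expect_strict_superadditive[OF p0 card c]) auto
    have e: "(1 - t) * expect p0 (f x) + t * expect p0 (f y) < expect p0 (f z)"
      using expect_strict_mono[of p0 "\<lambda>s. (1 - t) * f x s + t * f y s", OF p0(2) le less]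
      by (simp add: expect_linear)
    have "(2 * \<alpha> - 1) * ((1 - t) * ?m (f x) + t * ?m (f y))
        + 2 * (1 - \<alpha>) * ((1 - t) * expect p0 (f x) + t * expect p0 (f y))
        < (2 * \<alpha> - 1) * ?m (f z) + 2 * (1 - \<alpha>) * expect p0 (f z)"
    \<comment> \<open>For \<alpha> below 1 the strictness comes from the
      \<open>p0\<close>-expectation, since \<open>2 * \<alpha> - 1\<close> may vanish; at \<alpha> =
      1 only the minimum remains.\<close>
    proof (cases "\<alpha> = 1")
      case False
      then show ?thesis
        using assms(9) m e by (intro add_le_less_mono mult_left_mono mult_strict_left_mono) auto
    qed (use m in simp)
    then show ?thesis unfolding V z_def[symmetric] by (simp add: algebra_simps)
  qed
  ultimately show ?thesis unfolding strictly_concave_on_def by blast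
qed

end
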